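(* The construction $\mathsf{C}$ is a functor from the category of unitary magmas to the category of (nonsymmetric) operads: for every unitary magma $\mathcal{M}$, the graded vector space $\mathsf{C}\mathcal{M}$ with its partial compositions $\circ_i$ and unit $\mathbf{u}$ is an operad; for every unitary magma morphism $\theta:\mathcal{M}_1\to\mathcal{M}_2$, the linear map $\mathsf{C}\theta:\mathsf{C}\mathcal{M}_1\to\mathsf{C}\mathcal{M}_2$ is an operad morphism; and $\mathsf{C}$ preserves identities and compositions. Moreover, $\mathsf{C}$ respects injections and surjections: if $\theta$ is injective (resp. surjective), then $\mathsf{C}\theta$ is injective (resp. surjective).
   Context: Let $\mathbb{K}$ be a field of characteristic zero and $[n]=\{1,\dots,n\}$. A unitary magma is a set $\mathcal{M}$ with a binary operation $\star$ (not assumed associative) having a two-sided unit $\mathbb{1}_{\mathcal{M}}$; morphisms preserve the operation and the unit. Operad means nonsymmetric operad in $\mathbb{K}$-vector spaces: a graded vector space $\mathcal{O}=\bigoplus_{n\ge1}\mathcal{O}(n)$ with linear maps $\circ_i:\mathcal{O}(n)\otimes\mathcal{O}(m)\to\mathcal{O}(n+m-1)$ ($n,m\ge1$, $i\in[n]$) and an element $\mathbb{1}\in\mathcal{O}(1)$ such that, for $x\in\mathcal{O}(n)$, $y\in\mathcal{O}(m)$, $z\in\mathcal{O}(k)$: $(x\circ_i y)\circ_{i+j-1}z=x\circ_i(y\circ_j z)$ for $i\in[n],j\in[m]$; $(x\circ_i y)\circ_{j+m-1}z=(x\circ_j z)\circ_i y$ for $i<j$ in $[n]$; $\mathbb{1}\circ_1x=x=x\circ_i\mathbb{1}$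 for $i \in [n]$. Operad morphisms are linear maps that respect arities, units and partial compositions. An $\mathcal{M}$-clique of arity $n\ge1$ is a map $\mathfrak{p}$ assigning a label $\mathfrak{p}(x,y)\in\mathcal{M}$ to each arc $(x,y)$, $1\le x<y\le n+1$; by convention the only $\mathcal{M}$-clique of arity $1$ is $\mathbf{u}$, with $\mathbf{u}(1,2)=\mathbb{1}_{\mathcal{M}}$. Write $\mathfrak{p}_0:=\mathfrak{p}(1,n+1)$ and $\mathfrak{p}_i:=\mathfrak{p}(i,i+1)$ for $i\in[n]$. $\mathsf{C}\mathcal{M}(n)$ is the vector space with basis the $\mathcal{M}$-cliques of arity $n$, and $\mathsf{C}\mathcal{M}=\bigoplus_{n\ge1}\mathsf{C}\mathcal{M}(n)$. For $\mathcal{M}$-cliques $\mathfrak{p},\mathfrak{q}$ of arities $n,m$ and $i\in[n]$, $\mathfrak{p}\circ_i\mathfrak{q}$ is the $\mathcal{M}$-clique of arity $n+m-1$ with, for $1\le x<y\le n+m$, $$(\mathfrak{p}\circ_i\mathfrak{q})(x,y)=\begin{cases}\mathfrak{p}(x,y)&\text{if }y\le i,\\ \mathfrak{p}(x,y-m+1)&\text{if }x\le i<i+m\le y,\ (x,y)\ne(i,i+m),\\ \mathfrak{p}(x-m+1,y-m+1)&\text{if }i+m\le x,\\ \mathfrak{q}(x-i+1,y-i+1)&\text{if }i\le x<y\le i+m,\ (x,y)\ne(i,i+m),\\ \mathfrak{p}_i\star\mathfrak{q}_0&\text{if }(x,y)=(i,i+m),\\ \mathbb{1}_{\mathcal{M}}&\text{otherwise},\end{cases}$$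 extended bilinearly. For a unitary magma morphism $\theta:\mathcal{M}_1\to\mathcal{M}_2$, $\mathsf{C}\theta$ is the linear map sending an $\mathcal{M}_1$-clique $\mathfrak{p}$ to the $\mathcal{M}_2$-clique of the same arity with $((\mathsf{C}\theta)(\mathfrak{p}))(x,y)=\theta(\mathfrak{p}(x,y))$. *)

theory Defs
  imports Complex_Main "HOL-Algebra.Group" "HOL-Library.Poly_Mapping"
begin

(* The record of HOL-Algebra's monoids (carrier, operation, unit) is reused without
   its associativity axiom. *)
locale unitary_magma =
  fixes M :: "('a, 'x) monoid_scheme" (structure)
  assumes m_closed: "\<lbrakk>a \<in> carrier M; b \<in> carrier M\<rbrakk> \<Longrightarrow> a \<otimes> b \<in> carrier M"
    and one_closed: "\<one> \<in> carrier M"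
    and l_one: "a \<in> carrier M \<Longrightarrow> \<one> \<otimes> a = a"
    and r_one: "a \<in> carrier M \<Longrightarrow> a \<otimes> \<one> = a"

(* Morphisms between structures given by carrier sets are extensional functions, so that
   two of them are equal iff they agree on the carrier; the identity of M is then
   "restrict id (carrier M)" and composition is "compose". *)
definition unitary_magma_hom ::
    "('a, 'x) monoid_scheme \<Rightarrow> ('b, 'y) monoid_scheme \<Rightarrow> ('a \<Rightarrow> 'b) set" where
  "unitary_magma_hom M N =
     {\<theta> \<in> hom M N. \<theta> \<in> extensional (carrier M) \<and> \<theta> \<one>\<^bsub>M\<^esub> = \<one>\<^bsub>N\<^esub>}"


(* The components "grade P n" (only n >= 1 is relevant) are subspaces of an ambient vector
   space on the type 'v. They are required to be independent, so that their span
   is their direct sum. Elements of two distinct components are then never equal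
   unless both are 0, hence the partial compositions need no arity arguments. *)
record ('k, 'v) operad =
  grade :: "nat \<Rightarrow> 'v set"
  smul :: "'k \<Rightarrow> 'v \<Rightarrow> 'v"
  pcomp :: "nat \<Rightarrow> 'v \<Rightarrow> 'v \<Rightarrow> 'v"
  ounit :: "'v"

definition operad_space :: "('k::field, 'v::ab_group_add) operad \<Rightarrow> 'v set" where
  "operad_space P = module.span (smul P) (\<Union>n\<in>{1..}. grade P n)"

locale nonsymmetric_operad =
  fixes P :: "('k::field, 'v::ab_group_add) operad"
  assumes vector_space: "vector_space (smul P)"
    and subspace_grade: "n \<ge> 1 \<Longrightarrow> module.subspace (smul P) (grade P n)"
    and independent_grades:
      "\<lbrakk>finite S; S \<subseteq> {1..}; \<And>n. n \<in> S \<Longrightarrow> v n \<in> grade P n; (\<Sum>n\<in>S. v n) = 0\<rbrakk>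
        \<Longrightarrow> \<forall>n\<in>S. v n = 0"
    and pcomp_closed:
      "\<lbrakk>n \<ge> 1; m \<ge> 1; i \<in> {1..n}; x \<in> grade P n; y \<in> grade P m\<rbrakk>
        \<Longrightarrow> pcomp P i x y \<in> grade P (n + m - 1)"
    and pcomp_add_left:
      "\<lbrakk>n \<ge> 1; m \<ge> 1; i \<in> {1..n}; x \<in> grade P n; x' \<in> grade P n; y \<in> grade P m\<rbrakk>
        \<Longrightarrow> pcomp P i (x + x') y = pcomp P i x y + pcomp P i x' y"
    and pcomp_add_right:
      "\<lbrakk>n \<ge> 1; m \<ge> 1; i \<in> {1..n}; x \<in> grade P n; y \<in> grade P m; y' \<in> grade P m\<rbrakk>
        \<Longrightarrow> pcomp P i x (y + y') = pcomp P i x y + pcomp P i x y'"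
    and pcomp_smul_left:
      "\<lbrakk>n \<ge> 1; m \<ge> 1; i \<in> {1..n}; x \<in> grade P n; y \<in> grade P m\<rbrakk>
        \<Longrightarrow> pcomp P i (smul P c x) y = smul P c (pcomp P i x y)"
    and pcomp_smul_right:
      "\<lbrakk>n \<ge> 1; m \<ge> 1; i \<in> {1..n}; x \<in> grade P n; y \<in> grade P m\<rbrakk>
        \<Longrightarrow> pcomp P i x (smul P c y) = smul P c (pcomp P i x y)"
    and ounit_closed: "ounit P \<in> grade P 1"
    and sequential_assoc:
      "\<lbrakk>n \<ge> 1; m \<ge> 1; k \<ge> 1; x \<in> grade P n; y \<in> grade P m; z \<in> grade P k;
        i \<in> {1..n}; j \<in> {1..m}\<rbrakk>
        \<Longrightarrow> pcomp P (i + j - 1) (pcomp P i x y) z = pcomp P i x (pcomp P j y z)"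
    and parallel_assoc:
      "\<lbrakk>n \<ge> 1; m \<ge> 1; k \<ge> 1; x \<in> grade P n; y \<in> grade P m; z \<in> grade P k;
        i \<in> {1..n}; j \<in> {1..n}; i < j\<rbrakk>
        \<Longrightarrow> pcomp P (j + m - 1) (pcomp P i x y) z = pcomp P i (pcomp P j x z) y"
    and pcomp_unit_left:
      "\<lbrakk>n \<ge> 1; x \<in> grade P n\<rbrakk> \<Longrightarrow> pcomp P 1 (ounit P) x = x"
    and pcomp_unit_right:
      "\<lbrakk>n \<ge> 1; x \<in> grade P n; i \<in> {1..n}\<rbrakk> \<Longrightarrow> pcomp P i x (ounit P) = x"

definition operad_hom ::
    "('k::field, 'v::ab_group_add) operad \<Rightarrow> ('k, 'w::ab_group_add) operad \<Rightarrow> ('v \<Rightarrow> 'w) set"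
where
  "operad_hom P Q =
     {\<phi> \<in> operad_space P \<rightarrow>\<^sub>E operad_space Q.
        (\<forall>x\<in>operad_space P. \<forall>y\<in>operad_space P. \<phi> (x + y) = \<phi> x + \<phi> y) \<and>
        (\<forall>c. \<forall>x\<in>operad_space P. \<phi> (smul P c x) = smul Q c (\<phi> x)) \<and>
        (\<forall>n\<ge>1. \<forall>x\<in>grade P n. \<phi> x \<in> grade Q n) \<and>
        \<phi> (ounit P) = ounit Q \<and>
        (\<forall>n\<ge>1. \<forall>m\<ge>1. \<forall>i\<in>{1..n}. \<forall>x\<in>grade P n. \<forall>y\<in>grade P m.
           \<phi> (pcomp P i x y) = pcomp Q i (\<phi> x) (\<phi> y))}"


definition arcs :: "nat \<Rightarrow> (nat \<times> nat) set" where
  "arcs n = {(x, y). 1 \<le> x \<and> x < y \<and> y \<le> n + 1}"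

(* A clique is its arity together with its labelling, which is extensional on the arcs. *)
type_synonym 'a clique = "nat \<times> (nat \<times> nat \<Rightarrow> 'a)"

definition cliques :: "('a, 'x) monoid_scheme \<Rightarrow> nat \<Rightarrow> 'a clique set" where
  "cliques M n =
     {(n, p) | p. p \<in> arcs n \<rightarrow>\<^sub>E carrier M \<and> (n = 1 \<longrightarrow> p (1, 2) = \<one>\<^bsub>M\<^esub>)}"

definition unit_clique :: "('a, 'x) monoid_scheme \<Rightarrow> 'a clique" where
  "unit_clique M = (1, \<lambda>a\<in>arcs 1. \<one>\<^bsub>M\<^esub>)"

fun clique_pcomp ::
    "('a, 'x) monoid_scheme \<Rightarrow> nat \<Rightarrow> 'a clique \<Rightarrow> 'a clique \<Rightarrow> 'a clique" where
  "clique_pcomp M i (n, p) (m, q) =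
     (n + m - 1,
      \<lambda>(x, y)\<in>arcs (n + m - 1).
        if y \<le> i then p (x, y)
        else if x \<le> i \<and> i + m \<le> y \<and> (x, y) \<noteq> (i, i + m) then p (x, y - m + 1)
        else if i + m \<le> x then p (x - m + 1, y - m + 1)
        else if i \<le> x \<and> y \<le> i + m \<and> (x, y) \<noteq> (i, i + m) then q (x - i + 1, y - i + 1)
        else if (x, y) = (i, i + m) then p (i, i + 1) \<otimes>\<^bsub>M\<^esub> q (1, m + 1)
        else \<one>\<^bsub>M\<^esub>)"

fun clique_map :: "('a \<Rightarrow> 'b) \<Rightarrow> 'a clique \<Rightarrow> 'b clique" where
  "clique_map \<theta> (n, p) = (n, \<lambda>a\<in>arcs n. \<theta> (p a))"

(* Formal linear combinations of cliques are finitely supported functions; the component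
   of arity n consists of those supported on the cliques of arity n. The composition is
   the bilinear extension of clique_pcomp. *)
definition clique_operad ::
    "('a, 'x) monoid_scheme \<Rightarrow> ('k::field, 'a clique \<Rightarrow>\<^sub>0 'k) operad" where
  "clique_operad M =
     \<lparr>grade = (\<lambda>n. {f. Poly_Mapping.keys f \<subseteq> cliques M n}),
      smul = (\<lambda>c. Poly_Mapping.map ((*) c)),
      pcomp = (\<lambda>i f g. \<Sum>p\<in>Poly_Mapping.keys f. \<Sum>q\<in>Poly_Mapping.keys g.
         Poly_Mapping.single (clique_pcomp M i p q)
           (Poly_Mapping.lookup f p * Poly_Mapping.lookup g q)),
      ounit = Poly_Mapping.single (unit_clique M) 1\<rparr>"

(* The linear extension of clique_map; the magma argument is the source of \<theta>. *)
definition clique_operad_map ::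
    "('a, 'x) monoid_scheme \<Rightarrow> ('a \<Rightarrow> 'b) \<Rightarrow> ('a clique \<Rightarrow>\<^sub>0 'k) \<Rightarrow> ('b clique \<Rightarrow>\<^sub>0 'k::field)"
where
  "clique_operad_map M \<theta> =
     (\<lambda>f\<in>operad_space (clique_operad M).
        \<Sum>p\<in>Poly_Mapping.keys f.
          Poly_Mapping.single (clique_map \<theta> p) (Poly_Mapping.lookup f p))"

end

theory Submission
  imports Defs
begin

text \<open>
  Both the structure of the clique operad and the maps between clique operads are (bi)linear
  extensions of operations on the basis of cliques, so every assertion is verified on basis
  elements and transported to linear combinations.

  On the basis, each axiom is an equality of two labellings, checked arc by arc. The polygon
  of \<open>q\<close> occupies the vertices from \<open>i\<close> to \<open>i + m\<close> of the polygon of \<open>p \<circ>\<^sub>i q\<close>, and an arc of the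
  composite comes from \<open>p\<close>, comes from \<open>q\<close>, is the common edge, or crosses the common edge and is
  then labelled by the unit (\<open>comp_label_eqs\<close>). The two sides of an associativity axiom
  apply the magma operation to the same pair of labels at each glued edge, so associativity
  of the magma is not needed. The only exception would be the composition of three polygons
  along one and the same edge, in the sequential axiom with a middle clique of arity \<open>1\<close>; that
  clique is the unit clique, so the label in the middle is the unit of the magma. The unit
  laws of the magma give those of the operad.

  A magma morphism acts on labels, hence commutes with the composition of cliques
  (\<open>clique_map_pcomp\<close>). It acts injectively (surjectively) on the cliques when it is injective
  (surjective), and the linear extension of an injective (surjective) map between bases is
  injective (surjective): \<open>inj_on_pushforward\<close>, \<open>image_pushforward\<close>.
\<close>

section \<open>Linear extension of a map between bases\<close>

text \<open>Induction over the linear combinations of elements of a set \<open>B\<close>. It reduces identities between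
  additive expressions to the case of multiples of basis elements.\<close>

lemma poly_mapping_span_induct [consumes 1, case_names zero single add]:
  fixes f :: "'a \<Rightarrow>\<^sub>0 'k::comm_monoid_add"
  assumes "Poly_Mapping.keys f \<subseteq> B"
    and "P 0"
    and "\<And>p c. p \<in> B \<Longrightarrow> P (Poly_Mapping.single p c)"
    and "\<And>f g. Poly_Mapping.keys f \<subseteq> B \<Longrightarrow> Poly_Mapping.keys g \<subseteq> B \<Longrightarrow> P f \<Longrightarrow> P g \<Longrightarrow> P (f + g)"
  shows "P f"
proof -
  have decomp: "f = (\<Sum>p\<in>Poly_Mapping.keys f. Poly_Mapping.single p (Poly_Mapping.lookup f p))"
    by (rule poly_mapping_eqI)
      (auto simp: lookup_sum lookup_single when_def in_keys_iff sum.delta)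
  have "Poly_Mapping.keys (\<Sum>p\<in>S. Poly_Mapping.single p (Poly_Mapping.lookup f p)) \<subseteq> B \<and>
      P (\<Sum>p\<in>S. Poly_Mapping.single p (Poly_Mapping.lookup f p))" if "finite S" "S \<subseteq> B" for S
    using that
  proof (induction S rule: finite_induct)
    case (insert p S)
    then show ?case
      using keys_add[of "Poly_Mapping.single p (Poly_Mapping.lookup f p)"
          "\<Sum>p\<in>S. Poly_Mapping.single p (Poly_Mapping.lookup f p)"]
      by (auto intro!: assms simp: subset_iff split: if_splits)
  qed (simp add: assms)
  from this[of "Poly_Mapping.keys f"] show ?thesis
    using assms(1) decomp by simp
qed

text \<open>The linear extension of a map \<open>h\<close> from one basis to another: the coefficient of \<open>q\<close> in the image is
  the sum of the coefficients of \<open>f\<close> over the fibre of \<open>h\<close> at \<open>q\<close>.\<close>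

definition pushforward :: "('a \<Rightarrow> 'b) \<Rightarrow> ('a \<Rightarrow>\<^sub>0 'k::comm_monoid_add) \<Rightarrow> ('b \<Rightarrow>\<^sub>0 'k)" where
  "pushforward h f =
     (\<Sum>p\<in>Poly_Mapping.keys f. Poly_Mapping.single (h p) (Poly_Mapping.lookup f p))"

lemma pushforward_zero [simp]: "pushforward h 0 = 0"
  by (simp add: pushforward_def)

lemma pushforward_single [simp]:
  "pushforward h (Poly_Mapping.single p c) = Poly_Mapping.single (h p) c"
  by (simp add: pushforward_def)

lemma pushforward_add: "pushforward h (f + g) = pushforward h f + pushforward h g"
  unfolding pushforward_def
  by (rule setsum_keys_plus_distrib) (simp_all add: single_add)

lemma keys_pushforward: "Poly_Mapping.keys (pushforward h f) \<subseteq> h ` Poly_Mapping.keys f"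
  unfolding pushforward_def by (rule order.trans[OF keys_sum]) (auto split: if_splits)

lemma pushforward_pushforward:
  "pushforward h (pushforward g f) = pushforward (h \<circ> g) f"
  by (rule poly_mapping_span_induct[of f UNIV]) (simp_all add: pushforward_add)

lemma pushforward_cong:
  assumes "\<And>p. p \<in> Poly_Mapping.keys f \<Longrightarrow> g p = h p"
  shows "pushforward g f = pushforward h f"
  unfolding pushforward_def by (rule sum.cong) (simp_all add: assms)

lemma pushforward_id [simp]: "pushforward id f = f"
  by (rule poly_mapping_span_induct[of f UNIV]) (simp_all add: pushforward_add)

lemma inj_on_pushforward:
  assumes "inj_on h B"
  shows "inj_on (pushforward h) {f. Poly_Mapping.keys f \<subseteq> B}"
proof (rule inj_on_inverseI)
  fix f :: "'a \<Rightarrow>\<^sub>0 'k::comm_monoid_add"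
  assume "f \<in> {f. Poly_Mapping.keys f \<subseteq> B}"
  then have "pushforward (inv_into B h \<circ> h) f = pushforward id f"
    using assms by (intro pushforward_cong) auto
  then show "pushforward (inv_into B h) (pushforward h f) = f"
    by (simp add: pushforward_pushforward)
qed

lemma image_pushforward:
  "pushforward h ` {f :: 'a \<Rightarrow>\<^sub>0 'k::comm_monoid_add. Poly_Mapping.keys f \<subseteq> B}
    = {f. Poly_Mapping.keys f \<subseteq> h ` B}"
proof (intro equalityI subsetI)
  fix f :: "'b \<Rightarrow>\<^sub>0 'k" assume "f \<in> {f. Poly_Mapping.keys f \<subseteq> h ` B}"
  then have keys: "Poly_Mapping.keys f \<subseteq> h ` B" by simp
  then have "pushforward (h \<circ> inv_into B h) f = pushforward id f"
    by (intro pushforward_cong) (auto simp: f_inv_into_f)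
  then have "pushforward h (pushforward (inv_into B h) f) = f"
    by (simp add: pushforward_pushforward)
  moreover have "Poly_Mapping.keys (pushforward (inv_into B h) f) \<subseteq> B"
    by (rule order.trans[OF keys_pushforward]) (use keys in \<open>auto intro: inv_into_into\<close>)
  ultimately show "f \<in> pushforward h ` {f. Poly_Mapping.keys f \<subseteq> B}"
    by (intro image_eqI[where x = "pushforward (inv_into B h) f"]) simp_all
next
  fix f :: "'b \<Rightarrow>\<^sub>0 'k" assume "f \<in> pushforward h ` {f. Poly_Mapping.keys f \<subseteq> B}"
  then obtain g where g: "f = pushforward h g" "Poly_Mapping.keys g \<subseteq> B"
    by auto
  have "Poly_Mapping.keys f \<subseteq> h ` B"
    unfolding g(1) using keys_pushforward image_mono[OF g(2)] by (rule order.trans)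
  then show "f \<in> {f. Poly_Mapping.keys f \<subseteq> h ` B}" by simp
qed

lemma lookup_scale:
  fixes c :: "'k::mult_zero"
  shows "Poly_Mapping.lookup (Poly_Mapping.map ((*) c) f) p = c * Poly_Mapping.lookup f p"
  by (auto simp: Poly_Mapping.map.rep_eq when_def)

lemma keys_scale: 
  fixes c :: "'k::mult_zero"
  shows "Poly_Mapping.keys (Poly_Mapping.map ((*) c) f) \<subseteq> Poly_Mapping.keys f"
  by (auto simp: in_keys_iff lookup_scale)

lemma scale_add:
  fixes c :: "'k::semiring_0"
  shows "Poly_Mapping.map ((*) c) (f + g) = Poly_Mapping.map ((*) c) f + Poly_Mapping.map ((*) c) g"
  by (rule poly_mapping_eqI) (simp add: lookup_scale lookup_add distrib_left)

lemma scale_zero [simp]: "Poly_Mapping.map f 0 = 0"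
  by (simp add: map_eq_zero_iff)

lemma vector_space_scale: 
  "vector_space (\<lambda>c::'k::field. Poly_Mapping.map ((*) c) :: ('a \<Rightarrow>\<^sub>0 'k) \<Rightarrow> _)"
  by unfold_locales
    (auto intro!: poly_mapping_eqI simp: lookup_scale lookup_add algebra_simps)

lemma pushforward_scale:
  fixes c :: "'k::semiring_0"
  shows "pushforward h (Poly_Mapping.map ((*) c) f) = Poly_Mapping.map ((*) c) (pushforward h f)"
  by (rule poly_mapping_span_induct[of f UNIV])
    (simp_all add: pushforward_add scale_add)

lemma subspace_supported:
  fixes B :: "'b set"
  shows "module.subspace (\<lambda>c::'k::field. Poly_Mapping.map ((*) c))
    {f. Poly_Mapping.keys f \<subseteq> B}"
proof -
  interpret vector_space "\<lambda>c::'k::field. Poly_Mapping.map ((*) c) :: ('b \<Rightarrow>\<^sub>0 'k) \<Rightarrow> _"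
    by (rule vector_space_scale)
  show ?thesis
    unfolding subspace_def
  proof (intro conjI ballI allI)
    show "f + g \<in> {f. Poly_Mapping.keys f \<subseteq> B}"
      if "f \<in> {f. Poly_Mapping.keys f \<subseteq> B}" "g \<in> {f. Poly_Mapping.keys f \<subseteq> B}"
      for f g :: "'b \<Rightarrow>\<^sub>0 'k"
      using that keys_add[of f g] by blast
    show "Poly_Mapping.map ((*) c) f \<in> {f. Poly_Mapping.keys f \<subseteq> B}"
      if "f \<in> {f. Poly_Mapping.keys f \<subseteq> B}" for c and f :: "'b \<Rightarrow>\<^sub>0 'k"
      using that keys_scale[of c f] by blast
  qed simp
qed

section \<open>Labels of a composite clique\<close>

lemma cliquesE:
  assumes "p \<in> cliques M n" "n \<ge> 1"
  obtains n' a where "n = Suc n'" "p = (Suc n', a)" "a \<in> extensional (arcs (Suc n'))"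
    "\<And>x y. \<lbrakk>1 \<le> x; x < y; y \<le> Suc (Suc n')\<rbrakk> \<Longrightarrow> a (x, y) \<in> carrier M"
    "n' = 0 \<Longrightarrow> a (Suc 0, Suc (Suc 0)) = \<one>\<^bsub>M\<^esub>"
  using assms by (cases n) (auto simp: cliques_def arcs_def PiE_iff numeral_2_eq_2)

text \<open>The labelling of the composite of a clique \<open>a\<close> of arity \<open>n + 1\<close> with a clique \<open>b\<close> of arity \<open>m + 1\<close> at
  position \<open>i + 1\<close>. Arities and positions are shifted by one so that the natural subtractions in
  the composition formula become \<open>x - m\<close> and \<open>x - i\<close>; vertices are still numbered from \<open>1\<close>.\<close>

definition comp_label ::
    "('a, 'x) monoid_scheme \<Rightarrow> nat \<Rightarrow> nat \<Rightarrow> nat \<Rightarrow>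
      (nat \<times> nat \<Rightarrow> 'a) \<Rightarrow> (nat \<times> nat \<Rightarrow> 'a) \<Rightarrow> nat \<times> nat \<Rightarrow> 'a" where
  "comp_label M n i m a b = snd (clique_pcomp M (Suc i) (Suc n, a) (Suc m, b))"

lemma clique_pcomp_Suc:
  "clique_pcomp M (Suc i) (Suc n, a) (Suc m, b) = (Suc (n + m), comp_label M n i m a b)"
  by (simp add: comp_label_def)

declare clique_pcomp.simps [simp del]

lemma comp_label_extensional: "comp_label M n i m a b \<in> extensional (arcs (Suc (n + m)))"
  by (simp add: comp_label_def clique_pcomp.simps)

text \<open>The polygon of \<open>b\<close> occupies the vertices from \<open>i + 1\<close> to \<open>i + m + 2\<close>. The bounds on \<open>y - x\<close> in the
  second and fourth equations exclude the common edge by a linear condition.\<close>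

lemma comp_label_eqs:
  assumes "1 \<le> x" "x < y" "y \<le> Suc (Suc (n + m))"
  shows "y \<le> Suc i \<Longrightarrow> comp_label M n i m a b (x, y) = a (x, y)"
    and "\<lbrakk>x \<le> Suc i; Suc (Suc (i + m)) \<le> y; Suc (x + m) < y\<rbrakk>
      \<Longrightarrow> comp_label M n i m a b (x, y) = a (x, y - m)"
    and "Suc (Suc (i + m)) \<le> x \<Longrightarrow> comp_label M n i m a b (x, y) = a (x - m, y - m)"
    and "\<lbrakk>Suc i \<le> x; y \<le> Suc (Suc (i + m)); y < Suc (x + m)\<rbrakk>
      \<Longrightarrow> comp_label M n i m a b (x, y) = b (x - i, y - i)"
    and "\<lbrakk>x = Suc i; y = Suc (Suc (i + m))\<rbrakk> \<Longrightarrow>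
      comp_label M n i m a b (x, y) = a (Suc i, Suc (Suc i)) \<otimes>\<^bsub>M\<^esub> b (Suc 0, Suc (Suc m))"
    and "\<lbrakk>x < Suc i; Suc i < y; y < Suc (Suc (i + m))\<rbrakk>
      \<Longrightarrow> comp_label M n i m a b (x, y) = \<one>\<^bsub>M\<^esub>"
    and "\<lbrakk>Suc i < x; x < Suc (Suc (i + m)); Suc (Suc (i + m)) < y\<rbrakk>
      \<Longrightarrow> comp_label M n i m a b (x, y) = \<one>\<^bsub>M\<^esub>"
proof -
  let ?L = "comp_label M n i m a b (x, y)"
  have arc: "(x, y) \<in> arcs (Suc n + Suc m - 1)"
    using assms by (simp add: arcs_def)
  have L: "?L = (if y \<le> Suc i then a (x, y)
        else if x \<le> Suc i \<and> Suc i + Suc m \<le> y \<and> (x, y) \<noteq> (Suc i, Suc i + Suc m)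
        then a (x, y - Suc m + 1)
        else if Suc i + Suc m \<le> x then a (x - Suc m + 1, y - Suc m + 1)
        else if Suc i \<le> x \<and> y \<le> Suc i + Suc m \<and> (x, y) \<noteq> (Suc i, Suc i + Suc m)
        then b (x - Suc i + 1, y - Suc i + 1)
        else if (x, y) = (Suc i, Suc i + Suc m)
        then a (Suc i, Suc i + 1) \<otimes>\<^bsub>M\<^esub> b (1, Suc m + 1) else \<one>\<^bsub>M\<^esub>)"
    unfolding comp_label_def clique_pcomp.simps snd_conv restrict_def if_P[OF arc] split ..
  show "?L = a (x, y)" if "y \<le> Suc i"
    unfolding L using that by simp
  show "?L = a (x, y - m)"
    if "x \<le> Suc i" "Suc (Suc (i + m)) \<le> y" "Suc (x + m) < y"
  proof -
    have "\<not> y \<le> Suc i" "y - Suc m + 1 = y - m" using that by linarith+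
    then show ?thesis unfolding L using that by auto
  qed
  show "?L = a (x - m, y - m)" if "Suc (Suc (i + m)) \<le> x"
  proof -
    have "\<not> y \<le> Suc i" "\<not> x \<le> Suc i" "y - Suc m + 1 = y - m" "x - Suc m + 1 = x - m"
      using that assms by linarith+
    then show ?thesis unfolding L using that by simp
  qed
  show "?L = b (x - i, y - i)"
    if "Suc i \<le> x" "y \<le> Suc (Suc (i + m))" "y < Suc (x + m)"
  proof -
    have "\<not> y \<le> Suc i" "\<not> Suc i + Suc m \<le> x" "y - Suc i + 1 = y - i" "x - Suc i + 1 = x - i"
      "\<not> (x \<le> Suc i \<and> Suc i + Suc m \<le> y)"
      using that assms by linarith+
    then show ?thesis unfolding L using that by auto
  qed
  show "?L = a (Suc i, Suc (Suc i)) \<otimes>\<^bsub>M\<^esub> b (Suc 0, Suc (Suc m))"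
    if "x = Suc i" "y = Suc (Suc (i + m))"
    unfolding L using that by simp
  show "?L = \<one>\<^bsub>M\<^esub>"
    if "x < Suc i" "Suc i < y" "y < Suc (Suc (i + m))"
    unfolding L using that by simp
  show "?L = \<one>\<^bsub>M\<^esub>"
    if "Suc i < x" "x < Suc (Suc (i + m))" "Suc (Suc (i + m)) < y"
    unfolding L using that by simp
qed

text \<open>The position of an arc relative to the polygon inserted at position \<open>i + 1\<close>: the seven cases
  match the equations of \<open>comp_label_eqs\<close>.\<close>

lemma arc_cases [consumes 1, case_names before around after inside base crossing_left crossing_right]:
  fixes x y i m :: nat
  assumes "x < y"
  obtains "y \<le> Suc i"
  | "x \<le> Suc i" "Suc (Suc (i + m)) \<le> y" "Suc (x + m) < y"
  | "Suc (Suc (i + m)) \<le> x"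
  | "Suc i \<le> x" "y \<le> Suc (Suc (i + m))" "y < Suc (x + m)"
  | "x = Suc i" "y = Suc (Suc (i + m))"
  | "x < Suc i" "Suc i < y" "y < Suc (Suc (i + m))"
  | "Suc i < x" "x < Suc (Suc (i + m))" "Suc (Suc (i + m)) < y"
  using assms by linarith

lemma labelling_eqI:
  assumes "a \<in> extensional (arcs (Suc n))" "b \<in> extensional (arcs (Suc n))"
    and "\<And>x y. \<lbrakk>1 \<le> x; x < y; y \<le> Suc (Suc n)\<rbrakk> \<Longrightarrow> a (x, y) = b (x, y)"
  shows "a = b"
  by (rule extensionalityI[OF assms(1,2)]) (use assms(3) in \<open>auto simp: arcs_def\<close>)

section \<open>The operad axioms on cliques\<close>

context unitary_magma
begin

lemma clique_pcomp_closed: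
  assumes "n \<ge> 1" "m \<ge> 1" "i \<in> {1..n}" "p \<in> cliques M n" "q \<in> cliques M m"
  shows "clique_pcomp M i p q \<in> cliques M (n + m - 1)"
proof -
  obtain i' where i: "i = Suc i'"
    using assms(3) by (cases i) auto
  obtain n' a where a: "n = Suc n'" "p = (Suc n', a)"
    "\<And>x y. \<lbrakk>1 \<le> x; x < y; y \<le> Suc (Suc n')\<rbrakk> \<Longrightarrow> a (x, y) \<in> carrier M"
    "n' = 0 \<Longrightarrow> a (Suc 0, Suc (Suc 0)) = \<one>"
    using cliquesE[OF assms(4,1)] by metis
  obtain m' b where b: "m = Suc m'" "q = (Suc m', b)"
    "\<And>x y. \<lbrakk>1 \<le> x; x < y; y \<le> Suc (Suc m')\<rbrakk> \<Longrightarrow> b (x, y) \<in> carrier M"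
    "m' = 0 \<Longrightarrow> b (Suc 0, Suc (Suc 0)) = \<one>"
    using cliquesE[OF assms(5,2)] by metis
  have le: "i' \<le> n'" using assms(3) i a(1) by simp
  have closed: "comp_label M n' i' m' a b (x, y) \<in> carrier M"
    if "1 \<le> x" "x < y" "y \<le> Suc (Suc (n' + m'))" for x y
    using \<open>x < y\<close>
  proof (cases rule: arc_cases[where i = i' and m = m'])
    case around
    then show ?thesis using that le by (simp add: comp_label_eqs a(3))
  next
    case base
    then show ?thesis using that le by (simp add: comp_label_eqs a(3) b(3) m_closed)
  qed (use that le in \<open>simp_all add: comp_label_eqs a(3) b(3) one_closed\<close>)
  have "comp_label M n' i' m' a b (Suc 0, Suc (Suc 0)) = \<one>" if "n' = 0" "m' = 0"
    using that le a(4) b(4) by (simp add: comp_label_eqs(5) l_one one_closed)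
  then show ?thesis
    using closed comp_label_extensional[of M n' i' m' a b]
    by (auto simp: i a(1,2) b(1,2) clique_pcomp_Suc cliques_def PiE_iff arcs_def numeral_2_eq_2)
qed

text \<open>The three polygons are nested: an arc is first located relative to the polygon of \<open>q \<circ>\<^sub>j r\<close>, then
  relative to that of \<open>r\<close>.\<close>

lemma clique_pcomp_sequential:
  assumes "n \<ge> 1" "m \<ge> 1" "k \<ge> 1" "i \<in> {1..n}" "j \<in> {1..m}"
    and "p \<in> cliques M n" "q \<in> cliques M m" "r \<in> cliques M k"
  shows "clique_pcomp M (i + j - 1) (clique_pcomp M i p q) r
    = clique_pcomp M i p (clique_pcomp M j q r)"
proof -
  obtain i' j' where ij: "i = Suc i'" "j = Suc j'"
    using assms(4,5) by (cases i; cases j) auto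
  obtain n' a where a: "n = Suc n'" "p = (Suc n', a)"
    "\<And>x y. \<lbrakk>1 \<le> x; x < y; y \<le> Suc (Suc n')\<rbrakk> \<Longrightarrow> a (x, y) \<in> carrier M"
    using cliquesE[OF assms(6,1)] by metis
  obtain m' b where b: "m = Suc m'" "q = (Suc m', b)"
    "m' = 0 \<Longrightarrow> b (Suc 0, Suc (Suc 0)) = \<one>"
    using cliquesE[OF assms(7,2)] by metis
  obtain k' c where c: "k = Suc k'" "r = (Suc k', c)"
    "\<And>x y. \<lbrakk>1 \<le> x; x < y; y \<le> Suc (Suc k')\<rbrakk> \<Longrightarrow> c (x, y) \<in> carrier M"
    using cliquesE[OF assms(8,3)] by metis
  have le: "i' \<le> n'" "j' \<le> m'" using assms(4,5) ij a(1) b(1) by simp_all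
  have "comp_label M (n' + m') (i' + j') k' (comp_label M n' i' m' a b) c (x, y)
      = comp_label M n' i' (m' + k') a (comp_label M m' j' k' b c) (x, y)"
    if arc: "1 \<le> x" "x < y" "y \<le> Suc (Suc (n' + m' + k'))" for x y
    using \<open>x < y\<close>
  proof (cases rule: arc_cases[where i = i' and m = "m' + k'"])
    case before
    then show ?thesis using arc le by (simp add: comp_label_eqs(1))
  next
    case around
    then show ?thesis using arc le by (simp add: comp_label_eqs(2) add.commute)
  next
    case after
    then show ?thesis using arc le by (simp add: comp_label_eqs(3) add.commute)
  next
    case inside
    \<comment> \<open>Coordinates of the arc in the polygon of the inner composite.\<close>
    define x' y' where "x' = x - i'" and "y' = y - i'"
    then have x: "x = x' + i'" and y: "y = y' + i'"
      using inside arc by simp_all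
    have inside': "1 \<le> x'" "x' < y'" "y' \<le> Suc (Suc (m' + k'))" "y' < Suc (x' + m' + k')"
      using inside arc by (simp_all add: x y)
    have rhs: "comp_label M n' i' (m' + k') a (comp_label M m' j' k' b c) (x, y)
        = comp_label M m' j' k' b c (x', y')"
      using inside arc by (simp add: comp_label_eqs(4) x y)
    have "comp_label M (n' + m') (i' + j') k' (comp_label M n' i' m' a b) c (x, y)
        = comp_label M m' j' k' b c (x', y')"
      using \<open>x' < y'\<close>
    proof (cases rule: arc_cases[where i = j' and m = k'])
      case before
      then show ?thesis using le inside' by (simp add: x y comp_label_eqs(1,4))
    next
      case around
      then show ?thesis using le inside' by (simp add: x y comp_label_eqs(2,4))
    next
      case after
      then show ?thesis using le inside' by (simp add: x y comp_label_eqs(3,4))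
    next
      case inside
      then show ?thesis using le inside' by (simp add: x y comp_label_eqs(4))
    next
      case base
      then show ?thesis using le inside' by (simp add: x y comp_label_eqs(4,5))
    next
      case crossing_left
      then show ?thesis using le inside' by (simp add: x y comp_label_eqs(4,6))
    next
      case crossing_right
      then show ?thesis using le inside' by (simp add: x y comp_label_eqs(4,7))
    qed
    then show ?thesis unfolding rhs .
  next
    case base
    \<comment> \<open>The same edge is glued twice when the middle clique has arity 1; its label is then the unit.\<close>
    show ?thesis
    proof (cases "m' = 0")
      case True
      then show ?thesis using arc le base b(3) a(3) c(3)
        by (simp add: comp_label_eqs(5) l_one r_one)
    next
      case False
      then show ?thesis using arc le base
        by (simp add: comp_label_eqs(2,5))
    qed
  next
    case left: crossing_left
    show ?thesis
      using \<open>x < y\<close>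
    proof (cases rule: arc_cases[where i = "i' + j'" and m = k'])
      case before
      then show ?thesis using arc le left by (simp add: comp_label_eqs(1,6))
    next
      case around
      then show ?thesis using arc le left by (simp add: comp_label_eqs(2,6))
    next
      case crossing_left
      then show ?thesis using arc le left by (simp add: comp_label_eqs(6))
    qed (use left le in linarith)+
  next
    case right: crossing_right
    show ?thesis
      using \<open>x < y\<close>
    proof (cases rule: arc_cases[where i = "i' + j'" and m = k'])
      case around
      then show ?thesis using arc le right by (simp add: comp_label_eqs(2,7))
    next
      case after
      then show ?thesis using arc le right by (simp add: comp_label_eqs(3,7))
    next
      case crossing_right
      then show ?thesis using arc le right by (simp add: comp_label_eqs(7))
    qed (use right le in linarith)+
  qed
  then have "comp_label M (n' + m') (i' + j') k' (comp_label M n' i' m' a b) c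
      = comp_label M n' i' (m' + k') a (comp_label M m' j' k' b c)"
    using comp_label_extensional[of M "n' + m'"] comp_label_extensional[of M n' _ "m' + k'"]
    by (intro labelling_eqI[where n = "n' + m' + k'"]) (simp_all add: add.assoc)
  then show ?thesis
    by (simp add: ij a(1,2) b(1,2) c(1,2) clique_pcomp_Suc add.assoc)
qed

text \<open>The polygons of \<open>q\<close> and \<open>r\<close> share at most one vertex: an arc is first located relative to the
  former, then relative to the latter.\<close>

lemma clique_pcomp_parallel:
  assumes "n \<ge> 1" "m \<ge> 1" "k \<ge> 1" "i \<in> {1..n}" "j \<in> {1..n}" "i < j"
    and "p \<in> cliques M n" "q \<in> cliques M m" "r \<in> cliques M k"
  shows "clique_pcomp M (j + m - 1) (clique_pcomp M i p q) r
    = clique_pcomp M i (clique_pcomp M j p r) q"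
proof -
  obtain i' j' where ij: "i = Suc i'" "j = Suc j'"
    using assms(4,5) by (cases i; cases j) auto
  obtain n' a where a: "n = Suc n'" "p = (Suc n', a)"
    using cliquesE[OF assms(7,1)] by metis
  obtain m' b where b: "m = Suc m'" "q = (Suc m', b)"
    using cliquesE[OF assms(8,2)] by metis
  obtain k' c where c: "k = Suc k'" "r = (Suc k', c)"
    using cliquesE[OF assms(9,3)] by metis
  have le: "i' < j'" "j' \<le> n'" using assms(5,6) ij a(1) by simp_all
  have "comp_label M (n' + m') (j' + m') k' (comp_label M n' i' m' a b) c (x, y)
      = comp_label M (n' + k') i' m' (comp_label M n' j' k' a c) b (x, y)"
    if arc: "1 \<le> x" "x < y" "y \<le> Suc (Suc (n' + m' + k'))" for x y
    using \<open>x < y\<close>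
  proof (cases rule: arc_cases[where i = i' and m = m'])
    case before
    then show ?thesis using arc le by (simp add: comp_label_eqs(1))
  next
    case around_q: around
    show ?thesis
      using \<open>x < y\<close>
    proof (cases rule: arc_cases[where i = "j' + m'" and m = k'])
      case before
      then show ?thesis using arc le around_q by (simp add: comp_label_eqs(1,2))
    next
      case around
      then show ?thesis using arc le around_q by (simp add: comp_label_eqs(2) add.commute)
    next
      case crossing_left
      then show ?thesis using arc le around_q by (simp add: comp_label_eqs(2,6))
    qed (use around_q le in linarith)+
  next
    case after_q: after
    show ?thesis
      using \<open>x < y\<close>
    proof (cases rule: arc_cases[where i = "j' + m'" and m = k'])
      case before
      then show ?thesis using arc le after_q by (simp add: comp_label_eqs(1,3))
    next
      case around
      then show ?thesis using arc le after_q by (simp add: comp_label_eqs(2,3) add.commute)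
    next
      case after
      then show ?thesis using arc le after_q by (simp add: comp_label_eqs(3) add.commute)
    next
      case inside
      then show ?thesis using arc le after_q by (simp add: comp_label_eqs(3,4) add.commute)
    next
      case base
      then show ?thesis using arc le after_q by (simp add: comp_label_eqs(3,5))
    next
      case crossing_left
      then show ?thesis using arc le after_q by (simp add: comp_label_eqs(3,6))
    next
      case crossing_right
      then show ?thesis using arc le after_q by (simp add: comp_label_eqs(3,7))
    qed
  next
    case inside
    then show ?thesis using arc le by (simp add: comp_label_eqs(1,4))
  next
    case base
    then show ?thesis using arc le by (simp add: comp_label_eqs(1,5))
  next
    case crossing_left
    then show ?thesis using arc le by (simp add: comp_label_eqs(1,6))
  next
    case right: crossing_right
    show ?thesis
      using \<open>x < y\<close>
    proof (cases rule: arc_cases[where i = "j' + m'" and m = k'])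
      case before
      then show ?thesis using arc le right by (simp add: comp_label_eqs(1,7))
    next
      case around
      then show ?thesis using arc le right by (simp add: comp_label_eqs(2,7))
    next
      case crossing_left
      then show ?thesis using arc le right by (simp add: comp_label_eqs(6,7))
    qed (use right le in linarith)+
  qed
  then have "comp_label M (n' + m') (j' + m') k' (comp_label M n' i' m' a b) c
      = comp_label M (n' + k') i' m' (comp_label M n' j' k' a c) b"
    using comp_label_extensional[of M "n' + m'"] comp_label_extensional[of M "n' + k'" _ m']
    by (intro labelling_eqI[where n = "n' + m' + k'"]) (simp_all add: ac_simps)
  then show ?thesis
    by (simp add: ij a(1,2) b(1,2) c(1,2) clique_pcomp_Suc ac_simps)
qed

lemma unit_clique_closed: "unit_clique M \<in> cliques M 1"
  by (auto simp: unit_clique_def cliques_def arcs_def one_closed)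

lemma unit_clique_eq: "unit_clique M = (Suc 0, \<lambda>a\<in>arcs (Suc 0). \<one>)"
  by (simp add: unit_clique_def)

lemma clique_pcomp_unit_left:
  assumes "n \<ge> 1" "p \<in> cliques M n"
  shows "clique_pcomp M 1 (unit_clique M) p = p"
proof -
  obtain n' a where a: "n = Suc n'" "p = (Suc n', a)" "a \<in> extensional (arcs (Suc n'))"
    "\<And>x y. \<lbrakk>1 \<le> x; x < y; y \<le> Suc (Suc n')\<rbrakk> \<Longrightarrow> a (x, y) \<in> carrier M"
    using cliquesE[OF assms(2,1)] by metis
  define u where "u = (\<lambda>a\<in>arcs (Suc 0). \<one>)"
  have u: "u (Suc 0, Suc (Suc 0)) = \<one>"
    by (simp add: u_def arcs_def)
  have "comp_label M 0 0 n' u a (x, y) = a (x, y)"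
    if "1 \<le> x" "x < y" "y \<le> Suc (Suc n')" for x y
    using \<open>x < y\<close>
    by (cases rule: arc_cases[where i = 0 and m = n'])
      (use that in \<open>simp_all add: comp_label_eqs(4,5) u l_one a(4)\<close>)
  then have "comp_label M 0 0 n' u a = a"
    using comp_label_extensional[of M 0 0 n' u a] a(3) by (intro labelling_eqI) simp_all
  then show ?thesis
    using clique_pcomp_Suc[of M 0 0 u n' a] by (simp add: a(2) unit_clique_eq u_def)
qed

lemma clique_pcomp_unit_right:
  assumes "n \<ge> 1" "p \<in> cliques M n" "i \<in> {1..n}"
  shows "clique_pcomp M i p (unit_clique M) = p"
proof -
  obtain n' a where a: "n = Suc n'" "p = (Suc n', a)" "a \<in> extensional (arcs (Suc n'))"
    "\<And>x y. \<lbrakk>1 \<le> x; x < y; y \<le> Suc (Suc n')\<rbrakk> \<Longrightarrow> a (x, y) \<in> carrier M"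
    using cliquesE[OF assms(2,1)] by metis
  obtain i' where i: "i = Suc i'" "i' \<le> n'"
    using assms(3) a(1) by (cases i) auto
  define u where "u = (\<lambda>a\<in>arcs (Suc 0). \<one>)"
  have u: "u (Suc 0, Suc (Suc 0)) = \<one>"
    by (simp add: u_def arcs_def)
  have "comp_label M n' i' 0 a u (x, y) = a (x, y)"
    if "1 \<le> x" "x < y" "y \<le> Suc (Suc n')" for x y
    using \<open>x < y\<close>
    by (cases rule: arc_cases[where i = i' and m = 0])
      (use that in \<open>simp_all add: comp_label_eqs(1-3,5) u r_one a(4)\<close>)
  then have "comp_label M n' i' 0 a u = a"
    using comp_label_extensional[of M n' i' 0 a u] a(3) by (intro labelling_eqI) simp_all
  then show ?thesis
    using clique_pcomp_Suc[of M i' n' a 0 u] by (simp add: a(2) i(1) unit_clique_eq u_def)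
qed

end

section \<open>Action of a magma morphism on cliques\<close>

lemma unitary_magma_homD:
  assumes "\<theta> \<in> unitary_magma_hom M N"
  shows "a \<in> carrier M \<Longrightarrow> \<theta> a \<in> carrier N"
    and "\<lbrakk>a \<in> carrier M; b \<in> carrier M\<rbrakk> \<Longrightarrow> \<theta> (a \<otimes>\<^bsub>M\<^esub> b) = \<theta> a \<otimes>\<^bsub>N\<^esub> \<theta> b"
    and "\<theta> \<one>\<^bsub>M\<^esub> = \<one>\<^bsub>N\<^esub>"
  using assms by (auto simp: unitary_magma_hom_def hom_def)

lemma clique_map_closed:
  assumes "\<theta> \<in> unitary_magma_hom M N" "p \<in> cliques M n"
  shows "clique_map \<theta> p \<in> cliques N n"
  using assms(2) unitary_magma_homD[OF assms(1)]
  by (auto simp: cliques_def PiE_iff arcs_def)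

lemma clique_map_unit:
  assumes "\<theta> \<in> unitary_magma_hom M N"
  shows "clique_map \<theta> (unit_clique M) = unit_clique N"
  using unitary_magma_homD(3)[OF assms] by (auto simp: unit_clique_def restrict_def)

lemma clique_map_id:
  assumes "p \<in> cliques M n"
  shows "clique_map (restrict id (carrier M)) p = p"
  using assms by (force simp: cliques_def PiE_iff extensional_def)

lemma clique_map_compose:
  assumes "p \<in> cliques M n"
  shows "clique_map (compose (carrier M) \<eta> \<theta>) p = clique_map \<eta> (clique_map \<theta> p)"
  using assms by (auto simp: cliques_def PiE_iff compose_def intro!: restrict_ext)

lemma inj_on_clique_map:
  assumes "inj_on \<theta> (carrier M)"
  shows "inj_on (clique_map \<theta>) (\<Union>n\<in>{1..}. cliques M n)"
proof (rule inj_onI)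
  fix p q assume "p \<in> (\<Union>n\<in>{1..}. cliques M n)" "q \<in> (\<Union>n\<in>{1..}. cliques M n)"
    and eq: "clique_map \<theta> p = clique_map \<theta> q"
  then obtain n m a b where p: "p = (n, a)" "a \<in> arcs n \<rightarrow>\<^sub>E carrier M"
    and q: "q = (m, b)" "b \<in> arcs m \<rightarrow>\<^sub>E carrier M"
    by (auto simp: cliques_def)
  from eq have nm: "n = m" and "(\<lambda>z\<in>arcs n. \<theta> (a z)) = (\<lambda>z\<in>arcs n. \<theta> (b z))"
    by (auto simp: p q)
  then have "\<theta> (a z) = \<theta> (b z)" if "z \<in> arcs n" for z
    using that by (metis restrict_apply')
  then have "a z = b z" if "z \<in> arcs n" for z
    using that assms p(2) q(2) by (auto simp: nm inj_on_def PiE_iff)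
  then have "a = b"
    using p(2) q(2) by (intro extensionalityI[of a "arcs n"]) (auto simp: nm PiE_iff)
  then show "p = q" by (simp add: p q nm)
qed

lemma clique_map_image:
  assumes "unitary_magma M" "\<theta> \<in> unitary_magma_hom M N" "\<theta> ` carrier M = carrier N"
  shows "clique_map \<theta> ` cliques M n = cliques N n"
proof (intro equalityI subsetI)
  fix q assume "q \<in> cliques N n"
  then obtain b where q: "q = (n, b)" "b \<in> arcs n \<rightarrow>\<^sub>E carrier N" "n = 1 \<longrightarrow> b (1, 2) = \<one>\<^bsub>N\<^esub>"
    by (auto simp: cliques_def)
  interpret unitary_magma M by (rule assms(1))
  \<comment> \<open>Lifting the unit to the unit keeps the unique clique of arity 1 in the image.\<close>
  define lift where "lift c = (if c = \<one>\<^bsub>N\<^esub> then \<one>\<^bsub>M\<^esub> else inv_into (carrier M) \<theta> c)" for c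
  have lift: "lift c \<in> carrier M" "\<theta> (lift c) = c" if "c \<in> carrier N" for c
    using that unitary_magma_homD(3)[OF assms(2)] one_closed
    by (auto simp: lift_def assms(3)[symmetric] inv_into_into f_inv_into_f)
  have "(1, 2) \<in> arcs 1" by (simp add: arcs_def)
  then have "clique_map lift q \<in> cliques M n"
    using q lift by (auto simp: cliques_def PiE_iff lift_def)
  moreover have "clique_map \<theta> (clique_map lift q) = q"
    using q lift by (auto simp: PiE_iff extensional_def restrict_def)
  ultimately show "q \<in> clique_map \<theta> ` cliques M n" by (metis imageI)
qed (use clique_map_closed[OF assms(2)] in auto)

lemma clique_map_pcomp:
  assumes "\<theta> \<in> unitary_magma_hom M N" "n \<ge> 1" "m \<ge> 1" "i \<in> {1..n}"
    "p \<in> cliques M n" "q \<in> cliques M m"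
  shows "clique_map \<theta> (clique_pcomp M i p q)
    = clique_pcomp N i (clique_map \<theta> p) (clique_map \<theta> q)"
proof -
  note hom = unitary_magma_homD[OF assms(1)]
  obtain i' where i: "i = Suc i'"
    using assms(4) by (cases i) auto
  obtain n' a where a: "n = Suc n'" "p = (Suc n', a)"
    "\<And>x y. \<lbrakk>1 \<le> x; x < y; y \<le> Suc (Suc n')\<rbrakk> \<Longrightarrow> a (x, y) \<in> carrier M"
    using cliquesE[OF assms(5,2)] by metis
  obtain m' b where b: "m = Suc m'" "q = (Suc m', b)"
    "\<And>x y. \<lbrakk>1 \<le> x; x < y; y \<le> Suc (Suc m')\<rbrakk> \<Longrightarrow> b (x, y) \<in> carrier M"
    using cliquesE[OF assms(6,3)] by metis
  have le: "i' \<le> n'" using assms(4) i a(1) by simp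
  define a' b' where "a' = (\<lambda>z\<in>arcs (Suc n'). \<theta> (a z))" and "b' = (\<lambda>z\<in>arcs (Suc m'). \<theta> (b z))"
  have a': "\<theta> (a (x, y)) = a' (x, y)" if "1 \<le> x" "x < y" "y \<le> Suc (Suc n')" for x y
    using that by (simp add: a'_def arcs_def)
  have b': "\<theta> (b (x, y)) = b' (x, y)" if "1 \<le> x" "x < y" "y \<le> Suc (Suc m')" for x y
    using that by (simp add: b'_def arcs_def)
  have "\<theta> (comp_label M n' i' m' a b (x, y)) = comp_label N n' i' m' a' b' (x, y)"
    if "1 \<le> x" "x < y" "y \<le> Suc (Suc (n' + m'))" for x y
    using \<open>x < y\<close>
  proof (cases rule: arc_cases[where i = i' and m = m'])
    case base
    then show ?thesis using that le by (simp add: comp_label_eqs(5) hom(2) a(3) b(3) a' b')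
  qed (use that le in \<open>simp_all add: comp_label_eqs hom(3) a' b'\<close>)
  then have "(\<lambda>z\<in>arcs (Suc (n' + m')). \<theta> (comp_label M n' i' m' a b z))
      = comp_label N n' i' m' a' b'"
    using comp_label_extensional[of N n' i' m' a' b']
    by (intro labelling_eqI[where n = "n' + m'"]) (auto simp: arcs_def)
  then show ?thesis
    by (simp add: i a(2) b(2) clique_pcomp_Suc a'_def b'_def)
qed

declare clique_map.simps [simp del]

section \<open>Bilinear extension of the clique composition\<close>

lemma clique_operad_simps [simp]:
  "grade (clique_operad M) n = {f. Poly_Mapping.keys f \<subseteq> cliques M n}"
  "smul (clique_operad M) = (\<lambda>c. Poly_Mapping.map ((*) c))"
  "ounit (clique_operad M) = Poly_Mapping.single (unit_clique M) 1"
  by (simp_all add: clique_operad_def)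

lemma operad_space_clique_operad:
  "operad_space (clique_operad M :: ('k::field, 'a clique \<Rightarrow>\<^sub>0 'k) operad)
    = {f. Poly_Mapping.keys f \<subseteq> (\<Union>n\<in>{1..}. cliques M n)}"
  (is "?L = {f. _ f \<subseteq> ?B}")
proof -
  interpret vector_space "\<lambda>c::'k. Poly_Mapping.map ((*) c) :: ('a clique \<Rightarrow>\<^sub>0 'k) \<Rightarrow> _"
    by (rule vector_space_scale)
  show ?thesis
  proof (intro equalityI subsetI)
    fix f assume "f \<in> {f :: 'a clique \<Rightarrow>\<^sub>0 'k. Poly_Mapping.keys f \<subseteq> ?B}"
    then have "Poly_Mapping.keys f \<subseteq> ?B" by simp
    then show "f \<in> ?L"
    proof (induction rule: poly_mapping_span_induct)
      case (single p c)
      then show ?case by (auto simp: operad_space_def intro!: span_base)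
    qed (simp_all add: operad_space_def span_zero span_add)
  next
    fix f assume "f \<in> ?L"
    moreover have "span (\<Union>n\<in>{1..}. {f. Poly_Mapping.keys f \<subseteq> cliques M n})
        \<subseteq> {f :: 'a clique \<Rightarrow>\<^sub>0 'k. Poly_Mapping.keys f \<subseteq> ?B}"
      by (rule span_minimal) (auto intro: subspace_supported)
    ultimately show "f \<in> {f. Poly_Mapping.keys f \<subseteq> ?B}"
      by (auto simp: operad_space_def)
  qed
qed

lemma pcomp_single:
  "pcomp (clique_operad M) i (Poly_Mapping.single p c) (Poly_Mapping.single q d)
    = Poly_Mapping.single (clique_pcomp M i p q) (c * d)"
  by (simp add: clique_operad_def)

lemma pcomp_add_left:
  "pcomp (clique_operad M) i (f + f') g
    = pcomp (clique_operad M) i f g + pcomp (clique_operad M) i f' g"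
  unfolding clique_operad_def operad.simps
  by (rule setsum_keys_plus_distrib)
    (simp_all add: distrib_right single_add sum.distrib)

lemma pcomp_add_right:
  "pcomp (clique_operad M) i f (g + g')
    = pcomp (clique_operad M) i f g + pcomp (clique_operad M) i f g'"
proof -
  have "(\<Sum>q\<in>Poly_Mapping.keys (g + g'). Poly_Mapping.single (clique_pcomp M i p q)
          (Poly_Mapping.lookup f p * Poly_Mapping.lookup (g + g') q))
      = (\<Sum>q\<in>Poly_Mapping.keys g. Poly_Mapping.single (clique_pcomp M i p q)
          (Poly_Mapping.lookup f p * Poly_Mapping.lookup g q))
      + (\<Sum>q\<in>Poly_Mapping.keys g'. Poly_Mapping.single (clique_pcomp M i p q)
          (Poly_Mapping.lookup f p * Poly_Mapping.lookup g' q))" for p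
    by (rule setsum_keys_plus_distrib) (simp_all add: distrib_left single_add)
  then show ?thesis
    by (simp add: clique_operad_def sum.distrib)
qed

lemma pcomp_zero [simp]:
  "pcomp (clique_operad M) i 0 g = 0" "pcomp (clique_operad M) i f 0 = 0"
  by (simp_all add: clique_operad_def)

lemma pcomp_scale:
  "pcomp (clique_operad M) i (Poly_Mapping.map ((*) c) f) g
    = Poly_Mapping.map ((*) c) (pcomp (clique_operad M) i f g)" (is ?left)
  "pcomp (clique_operad M) i f (Poly_Mapping.map ((*) c) g)
    = Poly_Mapping.map ((*) c) (pcomp (clique_operad M) i f g)" (is ?right)
proof -
  have left: "pcomp (clique_operad M) i (Poly_Mapping.map ((*) c) f) (Poly_Mapping.single q d)
      = Poly_Mapping.map ((*) c) (pcomp (clique_operad M) i f (Poly_Mapping.single q d))" for q d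
    by (rule poly_mapping_span_induct[of f UNIV])
      (simp_all add: pcomp_single scale_add pcomp_add_left mult.assoc)
  have right: "pcomp (clique_operad M) i f (Poly_Mapping.single q (c * d))
      = Poly_Mapping.map ((*) c) (pcomp (clique_operad M) i f (Poly_Mapping.single q d))" for q d
    by (rule poly_mapping_span_induct[of f UNIV])
      (simp_all add: pcomp_single scale_add pcomp_add_left mult.left_commute)
  show ?left
    by (rule poly_mapping_span_induct[of g UNIV])
      (simp_all add: left pcomp_add_right scale_add)
  show ?right
    by (rule poly_mapping_span_induct[of g UNIV])
      (simp_all add: right pcomp_add_right scale_add)
qed

lemma keys_pcomp:
  "Poly_Mapping.keys (pcomp (clique_operad M) i f g)
    \<subseteq> (\<Union>p\<in>Poly_Mapping.keys f. \<Union>q\<in>Poly_Mapping.keys g. {clique_pcomp M i p q})"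
  unfolding clique_operad_def operad.simps
  by (intro order.trans[OF keys_sum] UN_mono order.refl) (auto split: if_splits)

lemma grade_subset_operad_space:
  assumes "n \<ge> 1" "f \<in> grade (clique_operad M) n"
  shows "f \<in> operad_space (clique_operad M :: ('k::field, 'a clique \<Rightarrow>\<^sub>0 'k) operad)"
  using assms by (auto simp: operad_space_clique_operad)

lemma keys_operad_space:
  fixes f :: "'a clique \<Rightarrow>\<^sub>0 'k::field"
  assumes "f \<in> operad_space (clique_operad M)" "p \<in> Poly_Mapping.keys f"
  shows "p \<in> cliques M (fst p)"
proof -
  obtain n where "p \<in> cliques M n"
    using assms unfolding operad_space_clique_operad by blast
  then show ?thesis by (auto simp: cliques_def)
qed

lemma (in unitary_magma) nonsymmetric_operad_clique_operad:
  "nonsymmetric_operad (clique_operad M :: ('k::field, 'a clique \<Rightarrow>\<^sub>0 'k) operad)"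
proof (rule nonsymmetric_operad.intro)
  fix n m k i j :: nat and x y z x' y' :: "'a clique \<Rightarrow>\<^sub>0 'k" and c :: 'k
  let ?P = "clique_operad M :: ('k, 'a clique \<Rightarrow>\<^sub>0 'k) operad"
  show "vector_space (smul ?P)"
    by (simp add: vector_space_scale)
  show "module.subspace (smul ?P) (grade ?P n)"
    by (simp add: subspace_supported)
  show "\<forall>n\<in>S. v n = 0"
    if "finite S" "S \<subseteq> {1..}" "\<And>n. n \<in> S \<Longrightarrow> v n \<in> grade ?P n" "(\<Sum>n\<in>S. v n) = 0" for S v
  proof (intro ballI poly_mapping_eqI)
    fix n p assume n: "n \<in> S"
    show "Poly_Mapping.lookup (v n) p = Poly_Mapping.lookup 0 p"
    proof (cases "p \<in> Poly_Mapping.keys (v n)")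
      case True
      \<comment> \<open>A clique determines its arity, so at most one summand has a coefficient at \<open>p\<close>.\<close>
      then have "fst p = n"
        using that(3)[OF n] by (auto simp: cliques_def)
      then have "Poly_Mapping.lookup (v m) p = 0" if "m \<in> S - {n}" for m
        using that \<open>\<And>n. n \<in> S \<Longrightarrow> v n \<in> grade ?P n\<close>[of m] not_in_keys_iff_lookup_eq_zero[of p "v m"]
        by (auto simp: cliques_def)
      then have "(\<Sum>m\<in>S. Poly_Mapping.lookup (v m) p) = Poly_Mapping.lookup (v n) p"
        using that(1) n by (simp add: sum.remove)
      then show ?thesis
        using that(4) by (metis lookup_sum)
    qed (simp add: in_keys_iff)
  qed
  show "ounit ?P \<in> grade ?P 1"
    using unit_clique_closed by simp
  show "pcomp ?P i (x + x') y = pcomp ?P i x y + pcomp ?P i x' y"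
    by (rule pcomp_add_left)
  show "pcomp ?P i x (y + y') = pcomp ?P i x y + pcomp ?P i x y'"
    by (rule pcomp_add_right)
  show "pcomp ?P i (smul ?P c x) y = smul ?P c (pcomp ?P i x y)"
    "pcomp ?P i x (smul ?P c y) = smul ?P c (pcomp ?P i x y)"
    by (simp_all add: pcomp_scale)
  assume n: "n \<ge> 1" and "x \<in> grade ?P n"
  then have x: "Poly_Mapping.keys x \<subseteq> cliques M n" by simp
  show "pcomp ?P 1 (ounit ?P) x = x"
    using x by (induction rule: poly_mapping_span_induct)
      (use clique_pcomp_unit_left[OF n] in \<open>simp_all add: pcomp_single pcomp_add_right\<close>)
  assume i: "i \<in> {1..n}"
  show "pcomp ?P i x (ounit ?P) = x"
    using x by (induction rule: poly_mapping_span_induct)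
      (use clique_pcomp_unit_right[OF n _ i] in \<open>simp_all add: pcomp_single pcomp_add_left\<close>)
  assume m: "m \<ge> 1" and "y \<in> grade ?P m"
  then have y: "Poly_Mapping.keys y \<subseteq> cliques M m" by simp
  show "pcomp ?P i x y \<in> grade ?P (n + m - 1)"
    using keys_pcomp[of M i x y] x y clique_pcomp_closed[OF n m i]
    unfolding clique_operad_simps by blast
  assume k: "k \<ge> 1" and "z \<in> grade ?P k"
  then have z: "Poly_Mapping.keys z \<subseteq> cliques M k" by simp
  show "pcomp ?P (i + j - 1) (pcomp ?P i x y) z = pcomp ?P i x (pcomp ?P j y z)"
    if j: "j \<in> {1..m}"
    using x
  proof (induction rule: poly_mapping_span_induct)
    case (single p a)
    show ?case
      using y
    proof (induction rule: poly_mapping_span_induct)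
      case q: (single q b)
      show ?case
        using z by (induction rule: poly_mapping_span_induct)
          (use clique_pcomp_sequential[OF n m k i j single(1) q(1)] in
            \<open>simp_all add: pcomp_single pcomp_add_right mult.assoc\<close>)
    qed (simp_all add: pcomp_add_left pcomp_add_right)
  qed (simp_all add: pcomp_add_left)
  show "pcomp ?P (j + m - 1) (pcomp ?P i x y) z = pcomp ?P i (pcomp ?P j x z) y"
    if j: "j \<in> {1..n}" "i < j"
    using x
  proof (induction rule: poly_mapping_span_induct)
    case (single p a)
    show ?case
      using y
    proof (induction rule: poly_mapping_span_induct)
      case q: (single q b)
      show ?case
        using z by (induction rule: poly_mapping_span_induct)
          (use clique_pcomp_parallel[OF n m k i j single(1) q(1)] in
            \<open>simp_all add: pcomp_single pcomp_add_left pcomp_add_right ac_simps\<close>)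
    qed (simp_all add: pcomp_add_left pcomp_add_right)
  qed (simp_all add: pcomp_add_left)
qed

section \<open>Functoriality\<close>

lemma pushforward_pcomp:
  fixes f g :: "'a clique \<Rightarrow>\<^sub>0 'k::field"
  assumes "Poly_Mapping.keys f \<subseteq> A" "Poly_Mapping.keys g \<subseteq> B"
    and "\<And>p q. \<lbrakk>p \<in> A; q \<in> B\<rbrakk> \<Longrightarrow> h (clique_pcomp M i p q) = clique_pcomp N i (h p) (h q)"
  shows "pushforward h (pcomp (clique_operad M) i f g)
    = pcomp (clique_operad N) i (pushforward h f) (pushforward h g)"
  using assms(1)
proof (induction rule: poly_mapping_span_induct)
  case (single p c)
  show ?case
    using assms(2)
    by (induction rule: poly_mapping_span_induct)
      (use single assms(3) in \<open>simp_all add: pcomp_single pcomp_add_right pushforward_add\<close>)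
qed (simp_all add: pcomp_add_left pushforward_add)

lemma clique_operad_map_eq:
  "clique_operad_map M \<theta>
    = restrict (pushforward (clique_map \<theta>))
        (operad_space (clique_operad M :: ('k::field, 'a clique \<Rightarrow>\<^sub>0 'k) operad))"
  unfolding clique_operad_map_def pushforward_def ..

lemma clique_operad_map_closed:
  assumes "\<theta> \<in> unitary_magma_hom M N"
    and "f \<in> operad_space (clique_operad M :: ('k::field, 'a clique \<Rightarrow>\<^sub>0 'k) operad)"
  shows "pushforward (clique_map \<theta>) f \<in> operad_space (clique_operad N)"
proof -
  have "clique_map \<theta> ` (\<Union>n\<in>{1..}. cliques M n) \<subseteq> (\<Union>n\<in>{1..}. cliques N n)"
    unfolding image_UN
    by (intro UN_mono order.refl image_subsetI) (rule clique_map_closed[OF assms(1)])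
  moreover have "Poly_Mapping.keys f \<subseteq> (\<Union>n\<in>{1..}. cliques M n)"
    using assms(2) by (simp add: operad_space_clique_operad)
  ultimately show ?thesis
    unfolding operad_space_clique_operad mem_Collect_eq
    by (rule order.trans[OF keys_pushforward order.trans[OF image_mono, rotated]])
qed

lemma clique_operad_map_hom:
  assumes "unitary_magma M" "\<theta> \<in> unitary_magma_hom M N"
  shows "clique_operad_map M \<theta> \<in>
    operad_hom (clique_operad M :: ('k::field, 'a clique \<Rightarrow>\<^sub>0 'k) operad) (clique_operad N)"
proof -
  let ?P = "clique_operad M :: ('k, 'a clique \<Rightarrow>\<^sub>0 'k) operad"
  let ?S = "operad_space ?P"
  interpret P: nonsymmetric_operad ?P
    using assms(1) by (rule unitary_magma.nonsymmetric_operad_clique_operad)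
  interpret V: vector_space "smul ?P" by (rule P.vector_space)
  have space: "f + g \<in> ?S" "smul ?P c f \<in> ?S" if "f \<in> ?S" "g \<in> ?S" for f g c
    using that V.span_add V.span_scale by (auto simp: operad_space_def)
  note grade = grade_subset_operad_space[where M = M and 'k = 'k]
  have unit: "ounit ?P \<in> ?S"
    using grade[OF _ P.ounit_closed] by simp
  note eq = clique_operad_map_eq[of M \<theta>, where 'k = 'k]
  show ?thesis
    unfolding operad_hom_def
  proof (intro CollectI conjI ballI allI impI)
    show "clique_operad_map M \<theta> \<in> ?S \<rightarrow>\<^sub>E operad_space (clique_operad N)"
      using clique_operad_map_closed[OF assms(2), where 'k = 'k] by (simp add: eq)
    show "clique_operad_map M \<theta> (x + y) = clique_operad_map M \<theta> x + clique_operad_map M \<theta> y"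
      if "x \<in> ?S" "y \<in> ?S" for x y
      using that space(1)[OF that] by (simp add: eq pushforward_add)
    show "clique_operad_map M \<theta> (smul ?P c x) = smul (clique_operad N) c (clique_operad_map M \<theta> x)"
      if "x \<in> ?S" for c x
      using that space(2)[OF that that, of c] by (simp add: eq pushforward_scale)
    show "clique_operad_map M \<theta> (ounit ?P) = ounit (clique_operad N)"
      using unit clique_map_unit[OF assms(2)] by (simp add: eq)
  next
    fix n x assume nx: "1 \<le> n" "x \<in> grade ?P n"
    have "Poly_Mapping.keys (pushforward (clique_map \<theta>) x) \<subseteq> cliques N n"
      using keys_pushforward[of "clique_map \<theta>" x] nx(2) clique_map_closed[OF assms(2)]
      unfolding clique_operad_simps by blast
    then show "clique_operad_map M \<theta> x \<in> grade (clique_operad N) n"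
      using grade[OF nx] by (simp add: eq)
  next
    fix n m i x y
    assume nm: "1 \<le> n" "1 \<le> m" "i \<in> {1..n}" and xy: "x \<in> grade ?P n" "y \<in> grade ?P m"
    have "n + m - 1 \<ge> 1"
      using nm(1,2) by simp
    then have "pcomp ?P i x y \<in> ?S"
      by (rule grade) (rule P.pcomp_closed[OF nm xy])
    moreover have "pushforward (clique_map \<theta>) (pcomp ?P i x y)
        = pcomp (clique_operad N) i (pushforward (clique_map \<theta>) x) (pushforward (clique_map \<theta>) y)"
      using xy clique_map_pcomp[OF assms(2) nm]
      by (intro pushforward_pcomp[of _ "cliques M n" _ "cliques M m"]) simp_all
    moreover have "x \<in> ?S" "y \<in> ?S"
      by (rule grade[OF nm(1) xy(1)], rule grade[OF nm(2) xy(2)])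
    ultimately show "clique_operad_map M \<theta> (pcomp ?P i x y)
        = pcomp (clique_operad N) i (clique_operad_map M \<theta> x) (clique_operad_map M \<theta> y)"
      by (simp add: eq)
  qed
qed

lemma clique_operad_map_id:
  "clique_operad_map M (restrict id (carrier M))
    = restrict id (operad_space (clique_operad M :: ('k::field, 'a clique \<Rightarrow>\<^sub>0 'k) operad))"
proof -
  have "pushforward (clique_map (restrict id (carrier M))) f = pushforward id f"
    if "f \<in> operad_space (clique_operad M)" for f :: "'a clique \<Rightarrow>\<^sub>0 'k"
    using clique_map_id[OF keys_operad_space[OF that]] by (intro pushforward_cong) simp
  then show ?thesis
    unfolding clique_operad_map_eq by (intro restrict_ext) simp
qed

lemma clique_operad_map_compose:
  assumes "\<theta> \<in> unitary_magma_hom M N"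
  shows "clique_operad_map M (compose (carrier M) \<eta> \<theta>)
    = compose (operad_space (clique_operad M :: ('k::field, 'a clique \<Rightarrow>\<^sub>0 'k) operad))
        (clique_operad_map N \<eta>) (clique_operad_map M \<theta>)"
proof -
  have "pushforward (clique_map (compose (carrier M) \<eta> \<theta>)) f
      = pushforward (clique_map \<eta> \<circ> clique_map \<theta>) f"
    if "f \<in> operad_space (clique_operad M)" for f :: "'a clique \<Rightarrow>\<^sub>0 'k"
    using clique_map_compose[OF keys_operad_space[OF that]] by (intro pushforward_cong) simp
  then show ?thesis
    using clique_operad_map_closed[OF assms, where 'k = 'k]
    unfolding clique_operad_map_eq compose_def
    by (intro restrict_ext) (simp add: pushforward_pushforward)
qed

lemma inj_on_clique_operad_map:
  assumes "inj_on \<theta> (carrier M)"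
  shows "inj_on (clique_operad_map M \<theta>)
    (operad_space (clique_operad M :: ('k::field, 'a clique \<Rightarrow>\<^sub>0 'k) operad))"
  unfolding clique_operad_map_eq inj_on_restrict_eq
  unfolding operad_space_clique_operad
  by (intro inj_on_pushforward inj_on_clique_map assms)

lemma clique_operad_map_image:
  assumes "unitary_magma M" "\<theta> \<in> unitary_magma_hom M N" "\<theta> ` carrier M = carrier N"
  shows "clique_operad_map M \<theta> `
      operad_space (clique_operad M :: ('k::field, 'a clique \<Rightarrow>\<^sub>0 'k) operad)
    = operad_space (clique_operad N)"
  by (simp add: clique_operad_map_eq operad_space_clique_operad image_pushforward image_UN
      clique_map_image[OF assms])

theorem theorem2p1p1:
  shows
    "(\<forall>M :: 'a monoid. unitary_magma M \<longrightarrow>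
        nonsymmetric_operad
          (clique_operad M :: ('k::field_char_0, 'a clique \<Rightarrow>\<^sub>0 'k) operad)) \<and>
     (\<forall>(M\<^sub>1 :: 'a monoid) (M\<^sub>2 :: 'b monoid) \<theta>.
        unitary_magma M\<^sub>1 \<longrightarrow> unitary_magma M\<^sub>2 \<longrightarrow> \<theta> \<in> unitary_magma_hom M\<^sub>1 M\<^sub>2 \<longrightarrow>
        clique_operad_map M\<^sub>1 \<theta> \<in>
          operad_hom (clique_operad M\<^sub>1 :: ('k, 'a clique \<Rightarrow>\<^sub>0 'k) operad) (clique_operad M\<^sub>2)) \<and>
     (\<forall>M :: 'a monoid. unitary_magma M \<longrightarrow>
        clique_operad_map M (restrict id (carrier M)) =
          restrict id (operad_space (clique_operad M :: ('k, 'a clique \<Rightarrow>\<^sub>0 'k) operad))) \<and>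
     (\<forall>(M\<^sub>1 :: 'a monoid) (M\<^sub>2 :: 'b monoid) (M\<^sub>3 :: 'c monoid) \<theta> \<eta>.
        unitary_magma M\<^sub>1 \<longrightarrow> unitary_magma M\<^sub>2 \<longrightarrow> unitary_magma M\<^sub>3 \<longrightarrow>
        \<theta> \<in> unitary_magma_hom M\<^sub>1 M\<^sub>2 \<longrightarrow> \<eta> \<in> unitary_magma_hom M\<^sub>2 M\<^sub>3 \<longrightarrow>
        clique_operad_map M\<^sub>1 (compose (carrier M\<^sub>1) \<eta> \<theta>) =
          compose (operad_space (clique_operad M\<^sub>1 :: ('k, 'a clique \<Rightarrow>\<^sub>0 'k) operad))
            (clique_operad_map M\<^sub>2 \<eta>) (clique_operad_map M\<^sub>1 \<theta>)) \<and>
     (\<forall>(M\<^sub>1 :: 'a monoid) (M\<^sub>2 :: 'b monoid) \<theta>.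
        unitary_magma M\<^sub>1 \<longrightarrow> unitary_magma M\<^sub>2 \<longrightarrow> \<theta> \<in> unitary_magma_hom M\<^sub>1 M\<^sub>2 \<longrightarrow>
        inj_on \<theta> (carrier M\<^sub>1) \<longrightarrow>
        inj_on (clique_operad_map M\<^sub>1 \<theta>)
          (operad_space (clique_operad M\<^sub>1 :: ('k, 'a clique \<Rightarrow>\<^sub>0 'k) operad))) \<and>
     (\<forall>(M\<^sub>1 :: 'a monoid) (M\<^sub>2 :: 'b monoid) \<theta>.
        unitary_magma M\<^sub>1 \<longrightarrow> unitary_magma M\<^sub>2 \<longrightarrow> \<theta> \<in> unitary_magma_hom M\<^sub>1 M\<^sub>2 \<longrightarrow>
        \<theta> ` carrier M\<^sub>1 = carrier M\<^sub>2 \<longrightarrow>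
        clique_operad_map M\<^sub>1 \<theta> `
            operad_space (clique_operad M\<^sub>1 :: ('k, 'a clique \<Rightarrow>\<^sub>0 'k) operad) =
          operad_space (clique_operad M\<^sub>2))"
  by (intro conjI allI impI)
    (assumption | rule unitary_magma.nonsymmetric_operad_clique_operad clique_operad_map_hom
      clique_operad_map_id clique_operad_map_compose inj_on_clique_operad_map
      clique_operad_map_image)+
end
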